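(* Let $(\mathcal W\times\mathcal T,\mathbf K(W|T))$ be a transition probability space and $\mathbf X:\mathcal W\times\mathcal T\dashrightarrow\mathcal X$, $\mathbf Y:\mathcal W\times\mathcal T\dashrightarrow\mathcal Y$, $\mathbf Z:\mathcal W\times\mathcal T\dashrightarrow\mathcal Z$ transitional random variables with joint kernel $\mathbf K(X,Y,Z|T)$. The following are equivalent: 1. $\mathbf X\perp\!\!\!\perp_{\mathbf K(W|T)}\mathbf Y\mid\mathbf Z$; 2. $\mathbf X\perp\!\!\!\perp_{\mathbf K(W|T)}\mathbf T\otimes\mathbf Y\mid\mathbf Z$; 3. $\mathbf X\perp\!\!\!\perp_{\mathbf K(W|T)}\boldsymbol\delta_\ast\mid\mathbf Z$ and $\mathbf K(X,Y,Z|T)=\mathbf R(X|Z)\otimes\mathbf K(Y,Z|T)$, where $\mathbf R(X|Z):\mathcal Z\dashrightarrow\mathcal X$ denotes any version of the Markov kernel appearing in $\mathbf X\perp\!\!\!\perp_{\mathbf K(W|T)}\boldsymbol\delta_\ast\mid\mathbf Z$, i.e. any Markov kernel with $\mathbf K(X,Z|T)=\mathbf R(X|Z)\otimes\mathbf K(Z|T)$ (the condition does not depend on the choice of version); 4. $\mathbf X\precsim^\ast_{\mathbf K}\mathbf Z$, and for every $t\in\mathcal T$ we have $X_t\perp\!\!\!\perp^\omega_{\mathbf K(X,Y,Z|T=t)}Y_t\mid Z_t$ in the weak sense. Furthermore, any of those points implies: 5. For every probability distribution $\mathbf Q(T)$ on $\mathcal T$: $\mathbf X\perp\!\!\!\perp_{\mathbf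 K(W|T)\otimes\mathbf Q(T)}\mathbf T\otimes\mathbf Y\mid\mathbf Z$.
   Context: A Markov kernel $\mathbf K(W|T):\mathcal T\dashrightarrow\mathcal W$ between measurable spaces assigns to each $t$ a probability measure $\mathbf K(W|T=t)$ on $\mathcal W$, measurably in $t$ on each measurable set. A transition probability space is a pair $(\mathcal W\times\mathcal T,\mathbf K(W|T))$ with $\mathbf K(W|T):\mathcal T\dashrightarrow\mathcal W$ a Markov kernel. A transitional random variable is a Markov kernel $\mathbf X:\mathcal W\times\mathcal T\dashrightarrow\mathcal X$. $\mathbf X\otimes\mathbf Y$ sends $(w,t)$ to the product measure of $\mathbf X(\cdot|w,t)$ and $\mathbf Y(\cdot|w,t)$. Joint kernels: $\mathbf K(X,Y,Z|T=t)(D)=\int(\mathbf X\otimes\mathbf Y\otimes\mathbf Z)(D|w,t)\,\mathbf K(W\in dw|T=t)$, with the corresponding marginals. Product: $(\mathbf Q(X|Z)\otimes\mathbf K(Y,Z|T))(A\times B\times C|t)=\int\mathbf 1_B(y)\mathbf 1_C(z)\mathbf Q(X\in A|Z=z)\,\mathbf K((Y,Z)\in d(y,z)|T=t)$. $\mathbf T$ is the Dirac kernel $(w,t)\mapsto\boldsymbol\delta_t$ on $\mathcal T$, and $\boldsymbol\delta_\ast$ the constant transitional random variable with values in the one-point space. Transitional conditional independence: $\mathbf X\perp\!\!\!\perp_{\mathbf K(W|T)}\mathbf Y\mid\mathbf Z$ means: there exists a Markov kernel $\mathbf Q(X|Z):\mathcal Z\dashrightarrow\mathcal X$ with $\mathbf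 K(X,Y,Z|T)=\mathbf Q(X|Z)\otimes\mathbf K(Y,Z|T)$. In 5., $\mathbf K(W|T)\otimes\mathbf Q(T)$ is the probability measure on $\mathcal W\times\mathcal T$ with value $\int_{D}\mathbf K(W\in B|T=t)\,\mathbf Q(T\in dt)$ on $B\times D$; it is regarded as a Markov kernel from the one-point space to $\mathcal W\times\mathcal T$, and $\mathbf X,\mathbf Y,\mathbf Z,\mathbf T$ as transitional random variables on the resulting transition probability space. So 5. says: there is a Markov kernel $\mathbf Q'(X|Z)$ with $\mathbf Q(X,T,Y,Z)=\mathbf Q'(X|Z)\otimes\mathbf Q(T,Y,Z)$ for the joint law $\mathbf Q(X,T,Y,Z)$. $\mathbf X\precsim^\ast_{\mathbf K}\mathbf Z$ means: there exists a Markov kernel $\mathbf Q(X|Z):\mathcal Z\dashrightarrow\mathcal X$ with $\mathbf K(X,Z|T)=\mathbf Q(X|Z)\otimes\mathbf K(Z|T)$. Weak conditional independence: $X_t,Y_t,Z_t$ are the coordinate random variables on $\mathcal X\times\mathcal Y\times\mathcal Z$ under the probability measure $\mathbf K(X,Y,Z|T=t)$, and $X_t\perp\!\!\!\perp^\omega Y_t\mid Z_t$ means that for every measurable $A\subseteq\mathcal X$, $\mathbb E_t[\mathbf 1_A(X_t)|Y_t,Z_t]=\mathbb E_t[\mathbf 1_A(X_t)|Z_t]$ almost surely, where $\mathbb E_t$ is expectation with respect to $\mathbf K(X,Y,Z|T=t)$. *)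

theory Defs
  imports "HOL-Probability.Probability"
begin

text \<open>
  A measurable space is represented by a measure of which only \<open>space\<close> and \<open>sets\<close> matter.
  Product spaces of three or four factors are nested to the right.
\<close>

text \<open>
  The sigma-algebra of \<open>prob_algebra N\<close> is generated by the evaluations on the measurable sets
  of \<open>N\<close>, so membership below is measurability of \<open>K\<close> on each measurable set.
\<close>

abbreviation markov_kernel :: "'a measure \<Rightarrow> 'b measure \<Rightarrow> ('a \<Rightarrow> 'b measure) \<Rightarrow> bool" where
  "markov_kernel M N K \<equiv> K \<in> M \<rightarrow>\<^sub>M prob_algebra N"

definition kernel_tensor ::
    "('a \<Rightarrow> 'x measure) \<Rightarrow> ('a \<Rightarrow> 'y measure) \<Rightarrow> 'a \<Rightarrow> ('x \<times> 'y) measure"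
    (infixr "\<otimes>\<^sub>K" 70) where
  "(X \<otimes>\<^sub>K Y) a = X a \<Otimes>\<^sub>M Y a"

text \<open>The point masses at the parameter (\<open>\<T>\<close> is the parameter space) and at the point \<open>*\<close>.\<close>

definition param_kernel :: "'t measure \<Rightarrow> 'w \<times> 't \<Rightarrow> 't measure" where
  "param_kernel \<T> = (\<lambda>(w, t). return \<T> t)"

abbreviation one_point :: "unit measure" where
  "one_point \<equiv> count_space UNIV"

definition star_kernel :: "'a \<Rightarrow> unit measure" where
  "star_kernel = (\<lambda>_. return one_point ())"

text \<open>
  For a transitional random variable \<open>U\<close> this is the kernel \<open>K(U | T)\<close>; joint kernels and their
  marginals are the cases \<open>U = X \<otimes>\<^sub>K Y \<otimes>\<^sub>K Z\<close>, \<open>U = Y \<otimes>\<^sub>K Z\<close>, \<open>U = Z\<close>, and so on.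
\<close>

definition joint_kernel ::
    "('t \<Rightarrow> 'w measure) \<Rightarrow> ('w \<times> 't \<Rightarrow> 'u measure) \<Rightarrow> 't \<Rightarrow> 'u measure" where
  "joint_kernel K U t = K t \<bind> (\<lambda>w. U (w, t))"

lemma emeasure_joint_kernel:
  assumes "markov_kernel \<T> \<W> K" "markov_kernel (\<W> \<Otimes>\<^sub>M \<T>) \<U> U" "t \<in> space \<T>" "D \<in> sets \<U>"
  shows "emeasure (joint_kernel K U t) D = (\<integral>\<^sup>+w. emeasure (U (w, t)) D \<partial>K t)"
proof -
  have "K t \<in> space (prob_algebra \<W>)"
    using assms(1,3) by (rule measurable_space)
  moreover have "(\<lambda>w. U (w, t)) \<in> \<W> \<rightarrow>\<^sub>M prob_algebra \<U>"
    using assms(2,3) by measurable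
  ultimately show ?thesis
    unfolding joint_kernel_def using assms(4) by (rule emeasure_bind_prob_algebra)
qed

text \<open>
  The product of a kernel \<open>Q\<close> from \<open>\<V>\<close> with a kernel \<open>L\<close> from the parameter space to \<open>\<V>\<close>:
  draw \<open>v\<close> from \<open>L t\<close>, then \<open>x\<close> from \<open>Q v\<close>, and return \<open>(x, v)\<close>.
\<close>

definition kernel_prod ::
    "'v measure \<Rightarrow> ('v \<Rightarrow> 'x measure) \<Rightarrow> ('t \<Rightarrow> 'v measure) \<Rightarrow> 't \<Rightarrow> ('x \<times> 'v) measure" where
  "kernel_prod \<V> Q L t = L t \<bind> (\<lambda>v. Q v \<Otimes>\<^sub>M return \<V> v)"

lemma emeasure_kernel_prod_Times:
  assumes "markov_kernel \<V> \<X> Q" "markov_kernel \<T> \<V> L" "t \<in> space \<T>"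
    and "A \<in> sets \<X>" "B \<in> sets \<V>"
  shows "emeasure (kernel_prod \<V> Q L t) (A \<times> B) =
    (\<integral>\<^sup>+v. indicator B v * emeasure (Q v) A \<partial>L t)"
proof -
  have L: "L t \<in> space (prob_algebra \<V>)"
    using assms(2,3) by (rule measurable_space)
  have m: "(\<lambda>v. Q v \<Otimes>\<^sub>M return \<V> v) \<in> \<V> \<rightarrow>\<^sub>M prob_algebra (\<X> \<Otimes>\<^sub>M \<V>)"
    using assms(1) by measurable
  have "emeasure (kernel_prod \<V> Q L t) (A \<times> B) =
      (\<integral>\<^sup>+v. emeasure (Q v \<Otimes>\<^sub>M return \<V> v) (A \<times> B) \<partial>L t)"
    unfolding kernel_prod_def by (rule emeasure_bind_prob_algebra[OF L m]) (use assms in auto)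
  also have "\<dots> = (\<integral>\<^sup>+v. indicator B v * emeasure (Q v) A \<partial>L t)"
  proof (rule nn_integral_cong)
    fix v assume "v \<in> space (L t)"
    with L have v: "v \<in> space \<V>"
      by (auto simp: space_prob_algebra dest: sets_eq_imp_space_eq)
    then have Q: "sets (Q v) = sets \<X>"
      using measurable_space[OF assms(1) v] by (simp add: space_prob_algebra)
    interpret R: prob_space "return \<V> v" by (rule prob_space_return[OF v])
    show "emeasure (Q v \<Otimes>\<^sub>M return \<V> v) (A \<times> B) = indicator B v * emeasure (Q v) A"
      using assms(4,5) Q by (subst R.emeasure_pair_measure_Times) (auto simp: mult.commute)
  qed
  finally show ?thesis .
qed

text \<open>\<open>K(X, Y, Z | T) = Q(X | Z) \<otimes> K(Y, Z | T)\<close>, where \<open>Q\<close> ignores the component \<open>y\<close> of \<open>(y, z)\<close>.\<close>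

definition factorizes3 ::
    "'t measure \<Rightarrow> 'y measure \<Rightarrow> 'z measure \<Rightarrow> ('t \<Rightarrow> 'w measure) \<Rightarrow>
     ('w \<times> 't \<Rightarrow> 'x measure) \<Rightarrow> ('w \<times> 't \<Rightarrow> 'y measure) \<Rightarrow> ('w \<times> 't \<Rightarrow> 'z measure) \<Rightarrow>
     ('z \<Rightarrow> 'x measure) \<Rightarrow> bool" where
  "factorizes3 \<T> \<Y> \<Z> K X Y Z Q \<longleftrightarrow>
    (\<forall>t\<in>space \<T>. joint_kernel K (X \<otimes>\<^sub>K Y \<otimes>\<^sub>K Z) t =
      kernel_prod (\<Y> \<Otimes>\<^sub>M \<Z>) (\<lambda>(y, z). Q z) (joint_kernel K (Y \<otimes>\<^sub>K Z)) t)"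

text \<open>\<open>K(X, Z | T) = Q(X | Z) \<otimes> K(Z | T)\<close>\<close>

definition factorizes2 ::
    "'t measure \<Rightarrow> 'z measure \<Rightarrow> ('t \<Rightarrow> 'w measure) \<Rightarrow>
     ('w \<times> 't \<Rightarrow> 'x measure) \<Rightarrow> ('w \<times> 't \<Rightarrow> 'z measure) \<Rightarrow> ('z \<Rightarrow> 'x measure) \<Rightarrow> bool" where
  "factorizes2 \<T> \<Z> K X Z Q \<longleftrightarrow>
    (\<forall>t\<in>space \<T>. joint_kernel K (X \<otimes>\<^sub>K Z) t = kernel_prod \<Z> Q (joint_kernel K Z) t)"

definition trans_cond_indep ::
    "'t measure \<Rightarrow> 'x measure \<Rightarrow> 'y measure \<Rightarrow> 'z measure \<Rightarrow> ('t \<Rightarrow> 'w measure) \<Rightarrow>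
     ('w \<times> 't \<Rightarrow> 'x measure) \<Rightarrow> ('w \<times> 't \<Rightarrow> 'y measure) \<Rightarrow> ('w \<times> 't \<Rightarrow> 'z measure) \<Rightarrow> bool" where
  "trans_cond_indep \<T> \<X> \<Y> \<Z> K X Y Z \<longleftrightarrow>
    (\<exists>Q. markov_kernel \<Z> \<X> Q \<and> factorizes3 \<T> \<Y> \<Z> K X Y Z Q)"

text \<open>The relation \<open>X \<precsim>\<^sup>* Z\<close> with respect to \<open>K\<close>.\<close>

definition star_below ::
    "'t measure \<Rightarrow> 'x measure \<Rightarrow> 'z measure \<Rightarrow> ('t \<Rightarrow> 'w measure) \<Rightarrow>
     ('w \<times> 't \<Rightarrow> 'x measure) \<Rightarrow> ('w \<times> 't \<Rightarrow> 'z measure) \<Rightarrow> bool" where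
  "star_below \<T> \<X> \<Z> K X Z \<longleftrightarrow>
    (\<exists>Q. markov_kernel \<Z> \<X> Q \<and> factorizes2 \<T> \<Z> K X Z Q)"

text \<open>
  Weak conditional independence of random variables (ordinary measurable maps) \<open>X\<close>, \<open>Y\<close> given
  \<open>Z\<close> on a probability space \<open>P\<close>. Conditioning on a random variable is conditioning on the
  sigma-algebra it generates.
\<close>

definition weak_cond_indep ::
    "'a measure \<Rightarrow> 'x measure \<Rightarrow> 'y measure \<Rightarrow> 'z measure \<Rightarrow>
     ('a \<Rightarrow> 'x) \<Rightarrow> ('a \<Rightarrow> 'y) \<Rightarrow> ('a \<Rightarrow> 'z) \<Rightarrow> bool" where
  "weak_cond_indep P \<X> \<Y> \<Z> X Y Z \<longleftrightarrow>
    (\<forall>A\<in>sets \<X>. AE a in P.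
      real_cond_exp P (vimage_algebra (space P) (\<lambda>a. (Y a, Z a)) (\<Y> \<Otimes>\<^sub>M \<Z>))
        (\<lambda>a. indicator A (X a)) a =
      real_cond_exp P (vimage_algebra (space P) Z \<Z>) (\<lambda>a. indicator A (X a)) a)"

text \<open>
  The measure \<open>K(W | T) \<otimes> Q(T)\<close> on \<open>\<W> \<times> \<T>\<close>, as a kernel from the one-point space.
\<close>

definition mixture_kernel ::
    "'t measure \<Rightarrow> ('t \<Rightarrow> 'w measure) \<Rightarrow> 't measure \<Rightarrow> unit \<Rightarrow> ('w \<times> 't) measure" where
  "mixture_kernel \<T> K Q = kernel_prod \<T> K (\<lambda>_. Q)"

text \<open>
  A kernel on \<open>\<W> \<times> \<T>\<close> regarded as a transitional random variable on the transition
  probability space \<open>(\<W> \<times> \<T>) \<times> {*}\<close>.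
\<close>

definition lift_rv :: "('a \<Rightarrow> 'x measure) \<Rightarrow> 'a \<times> unit \<Rightarrow> 'x measure" where
  "lift_rv X = (\<lambda>(a, _). X a)"

end

theory Submission
  imports Defs
begin

text \<open>
  The equation \<open>K(X, V | T) = Q(X | V) \<otimes> K(V | T)\<close> says that, under the joint law at each \<open>t\<close>, the
  kernel \<open>Q\<close> is a regular conditional distribution of \<open>X\<close> given \<open>V\<close>: for every measurable \<open>A\<close>, the
  random variable \<open>Q(A | V)\<close> is a version of the conditional expectation of the indicator of
  \<open>X \<in> A\<close> given \<open>V\<close> (\<open>kernel_prod_eq_iff_cond_exp\<close>). So \<open>K(X, Z | T) = Q(X | Z) \<otimes> K(Z | T)\<close> holds
  iff \<open>Q(A | Z)\<close> is the conditional expectation given \<open>Z\<close>, and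
  \<open>K(X, Y, Z | T) = Q(X | Z) \<otimes> K(Y, Z | T)\<close> holds iff \<open>Q(A | Z)\<close> is the conditional expectation
  given \<open>(Y, Z)\<close>. Granted the first equation, the second one thus says that the two conditional
  expectations agree for every \<open>t\<close>, which is weak conditional independence and does not mention
  \<open>Q\<close> (\<open>factorizes3_iff_weak_cond_indep\<close>). Since the second equation implies the first by
  marginalization, points 1, 3 and 4 are equivalent, and no choice of version matters.

  The remaining equivalences are pushforwards. If \<open>Q\<close> depends on the conditioning variable \<open>v\<close> only
  through \<open>g v\<close>, then a factorization over \<open>V\<close> is carried by \<open>g\<close> to one over \<open>g V\<close>
  (\<open>factorization_push\<close>). For fixed \<open>t\<close> the maps \<open>y \<mapsto> (t, y)\<close> and \<open>(t, y) \<mapsto> y\<close> exchange \<open>Y\<close> and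
  \<open>T \<otimes> Y\<close>, which gives the equivalence of 1 and 2; inserting or dropping the one-point component
  identifies the first half of 3 with \<open>X \<precsim>\<^sup>* Z\<close>. Finally, joint laws under \<open>K(W | T) \<otimes> \<mu>(T)\<close>
  are the mixtures over \<open>t\<close> of those under \<open>K(W | T = t)\<close>, and the kernel product is linear in its
  second factor, so integrating 2 against \<open>\<mu>\<close> gives 5 with the same \<open>Q\<close>.
\<close>

section \<open>Kernels and product measures\<close>

lemma kernel_at:
  assumes "markov_kernel M N K" "a \<in> space M"
  shows "sets (K a) = sets N" "space (K a) = space N" "prob_space (K a)" "K a \<in> space (prob_algebra N)"
  using measurable_space[OF assms] by (auto simp: space_prob_algebra dest: sets_eq_imp_space_eq)

text \<open>Rectangles form a generator that is stable under intersection and contains the whole space.\<close>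

lemma prob_measure_eqI_Times:
  assumes "prob_space M" "prob_space N" "sets M = sets (A \<Otimes>\<^sub>M B)" "sets N = sets (A \<Otimes>\<^sub>M B)"
    and eq: "\<And>a b. a \<in> sets A \<Longrightarrow> b \<in> sets B \<Longrightarrow> emeasure M (a \<times> b) = emeasure N (a \<times> b)"
  shows "M = N"
proof (rule measure_eqI_generator_eq[OF Int_stable_pair_measure_generator[of A B],
      where \<Omega> = "space A \<times> space B" and A = "\<lambda>_. space A \<times> space B"])
  show "{a \<times> b |a b. a \<in> sets A \<and> b \<in> sets B} \<subseteq> Pow (space A \<times> space B)"
    using sets.space_closed[of A] sets.space_closed[of B] by auto
  show "emeasure M (space A \<times> space B) \<noteq> \<infinity>" for i :: nat
    using finite_measure.emeasure_finite[OF prob_space.finite_measure[OF assms(1)]] by simp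
qed (use assms in \<open>auto simp: sets_pair_measure\<close>)

lemma pair_measure_return:
  assumes x: "x \<in> space N" and M: "prob_space M"
  shows "M \<Otimes>\<^sub>M return N x = distr M (M \<Otimes>\<^sub>M N) (\<lambda>y. (y, x))"
proof (rule pair_measure_eqI)
  show "sigma_finite_measure M" "sigma_finite_measure (return N x)"
    using M prob_space_return[OF x] by (auto simp: prob_space_imp_sigma_finite)
next
  fix A B assume A[measurable]: "A \<in> sets M" and "B \<in> sets (return N x)"
  then have B[measurable]: "B \<in> sets N" by simp
  have [measurable]: "(\<lambda>y. (y, x)) \<in> M \<rightarrow>\<^sub>M M \<Otimes>\<^sub>M N" using x by simp
  have "(\<lambda>y. (y, x)) -` (A \<times> B) \<inter> space M = (if x \<in> B then A else {})"
    using sets.sets_into_space[OF A] by auto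
  then show "emeasure M A * emeasure (return N x) B = emeasure (distr M (M \<Otimes>\<^sub>M N) (\<lambda>y. (y, x))) (A \<times> B)"
    using B by (simp add: emeasure_distr pair_measureI)
qed simp

lemma return_pair_measure:
  assumes x: "x \<in> space N" and M: "prob_space M"
  shows "return N x \<Otimes>\<^sub>M M = distr M (N \<Otimes>\<^sub>M M) (Pair x)"
proof -
  have m: "(\<lambda>y. (y, x)) \<in> M \<rightarrow>\<^sub>M M \<Otimes>\<^sub>M N" using x by simp
  interpret M: prob_space M by (rule M)
  interpret N: prob_space "return N x" by (rule prob_space_return[OF x])
  interpret pair_prob_space "return N x" M ..
  have "return N x \<Otimes>\<^sub>M M =
      distr (M \<Otimes>\<^sub>M return N x) (return N x \<Otimes>\<^sub>M M) (\<lambda>(y, x). (x, y))"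
    by (rule distr_pair_swap)
  also have "\<dots> = distr (M \<Otimes>\<^sub>M return N x) (N \<Otimes>\<^sub>M M) (\<lambda>(y, x). (x, y))"
    by (rule distr_cong) (simp_all cong: sets_pair_measure_cong)
  also have "\<dots> = distr M (N \<Otimes>\<^sub>M M) (Pair x)"
    unfolding pair_measure_return[OF x M] by (subst distr_distr[OF _ m]) (simp_all add: comp_def)
  finally show ?thesis .
qed

lemma distr_snd_pair_measure:
  assumes M: "prob_space M" and N: "prob_space N" and sets: "sets N = sets N'"
  shows "distr (M \<Otimes>\<^sub>M N) N' snd = N"
proof -
  interpret M: prob_space M by (rule M)
  interpret N: prob_space N by (rule N)
  have snd: "snd \<in> M \<Otimes>\<^sub>M N \<rightarrow>\<^sub>M N'"
    using measurable_snd[of M N] measurable_cong_sets[OF refl sets] by blast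
  show ?thesis
  proof (rule measure_eqI)
    fix A assume "A \<in> sets (distr (M \<Otimes>\<^sub>M N) N' snd)"
    then have A': "A \<in> sets N'" by simp
    then have A: "A \<in> sets N" by (simp only: sets)
    have "snd -` A \<inter> space (M \<Otimes>\<^sub>M N) = space M \<times> A"
      using sets.sets_into_space[OF A] by (auto simp: space_pair_measure)
    then have "emeasure (distr (M \<Otimes>\<^sub>M N) N' snd) A = emeasure (M \<Otimes>\<^sub>M N) (space M \<times> A)"
      by (simp only: emeasure_distr[OF snd A'])
    also have "\<dots> = emeasure N A"
      by (simp only: N.emeasure_pair_measure_Times[OF sets.top A] M.emeasure_space_1 mult_1)
    finally show "emeasure (distr (M \<Otimes>\<^sub>M N) N' snd) A = emeasure N A" .
  qed (simp add: sets)
qed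

lemma distr_pair_measure_map:
  assumes N: "prob_space N" and sets: "sets M = sets \<X>" "sets N = sets \<V>"
    and f: "f \<in> \<X> \<rightarrow>\<^sub>M \<X>'" and g: "g \<in> \<V> \<rightarrow>\<^sub>M \<V>'"
  shows "distr (M \<Otimes>\<^sub>M N) (\<X>' \<Otimes>\<^sub>M \<V>') (\<lambda>(x, v). (f x, g v)) = distr M \<X>' f \<Otimes>\<^sub>M distr N \<V>' g"
proof -
  have gN: "g \<in> N \<rightarrow>\<^sub>M \<V>'" using g sets(2) by (simp cong: measurable_cong_sets)
  have fM: "f \<in> M \<rightarrow>\<^sub>M \<X>'" using f sets(1) by (simp cong: measurable_cong_sets)
  show ?thesis
    using prob_space.prob_space_distr[OF N gN]
    by (intro pair_measure_distr[OF fM gN, symmetric]) (simp add: prob_space_imp_sigma_finite)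
qed

section \<open>Kernel products are regular conditional distributions\<close>

lemma kernel_prod_in_prob_algebra:
  assumes Q: "markov_kernel \<V> \<X> Q" and L: "L t \<in> space (prob_algebra \<V>)"
  shows "kernel_prod \<V> Q L t \<in> space (prob_algebra (\<X> \<Otimes>\<^sub>M \<V>))"
proof -
  have m: "(\<lambda>v. Q v \<Otimes>\<^sub>M return \<V> v) \<in> \<V> \<rightarrow>\<^sub>M prob_algebra (\<X> \<Otimes>\<^sub>M \<V>)"
    using Q by measurable
  show ?thesis
    using prob_space_bind'[OF L m] sets_bind'[OF L m] by (simp add: space_prob_algebra kernel_prod_def)
qed

text \<open>
  The sets of the sigma-algebra generated by \<open>V\<close> are exactly the preimages \<open>V -` E\<close>, so testing a
  candidate \<open>g \<circ> V\<close> for the conditional expectation given \<open>V\<close> amounts to comparing integrals over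
  these preimages.
\<close>

lemma real_cond_exp_vimage_iff:
  fixes f :: "'a \<Rightarrow> real" and g :: "'v \<Rightarrow> real"
  assumes P: "prob_space P" and V[measurable]: "V \<in> P \<rightarrow>\<^sub>M \<V>"
    and f: "integrable P f" and g[measurable]: "g \<in> borel_measurable \<V>"
    and gV: "integrable P (\<lambda>\<omega>. g (V \<omega>))"
  shows "(AE \<omega> in P. real_cond_exp P (vimage_algebra (space P) V \<V>) f \<omega> = g (V \<omega>)) \<longleftrightarrow>
    (\<forall>E\<in>sets \<V>. (\<integral>\<omega>\<in>V -` E \<inter> space P. f \<omega> \<partial>P) = (\<integral>\<omega>\<in>V -` E \<inter> space P. g (V \<omega>) \<partial>P))"
proof -
  interpret P: prob_space P by (rule P)
  let ?F = "vimage_algebra (space P) V \<V>"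
  have VF: "V \<in> space P \<rightarrow> space \<V>" using measurable_space[OF V] by auto
  have setsF: "sets ?F = {V -` E \<inter> space P |E. E \<in> sets \<V>}"
    by (rule sets_vimage_algebra2[OF VF])
  have sub: "subalgebra P ?F"
    unfolding subalgebra_def by (auto simp: setsF)
  interpret F: finite_measure_subalgebra P ?F
    by unfold_locales (rule sub)
  note [measurable] = borel_measurable_integrable[OF f]
  have gF: "(\<lambda>\<omega>. g (V \<omega>)) \<in> borel_measurable ?F"
    by (rule measurable_compose[OF measurable_vimage_algebra1[OF VF] g])
  show ?thesis
  proof (intro iffI ballI)
    fix E assume ae: "AE \<omega> in P. real_cond_exp P ?F f \<omega> = g (V \<omega>)" and E[measurable]: "E \<in> sets \<V>"
    have "(\<integral>\<omega>\<in>V -` E \<inter> space P. f \<omega> \<partial>P) = (\<integral>\<omega>\<in>V -` E \<inter> space P. real_cond_exp P ?F f \<omega> \<partial>P)"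
      by (rule F.real_cond_exp_intA[OF f in_vimage_algebra[OF E]])
    also have "\<dots> = (\<integral>\<omega>\<in>V -` E \<inter> space P. g (V \<omega>) \<partial>P)"
      by (rule set_lebesgue_integral_cong_AE) (use ae in auto)
    finally show "(\<integral>\<omega>\<in>V -` E \<inter> space P. f \<omega> \<partial>P) = (\<integral>\<omega>\<in>V -` E \<inter> space P. g (V \<omega>) \<partial>P)" .
  next
    assume "\<forall>E\<in>sets \<V>. (\<integral>\<omega>\<in>V -` E \<inter> space P. f \<omega> \<partial>P) = (\<integral>\<omega>\<in>V -` E \<inter> space P. g (V \<omega>) \<partial>P)"
    then show "AE \<omega> in P. real_cond_exp P ?F f \<omega> = g (V \<omega>)"
      by (intro F.real_cond_exp_charact) (auto simp: setsF f gV gF)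
  qed
qed

text \<open>
  Both laws are determined by their values on rectangles \<open>A \<times> E\<close>. These values are the integrals
  over \<open>V -` E\<close> of the indicator of \<open>X \<in> A\<close> and of \<open>Q(A | V)\<close> respectively; for fixed \<open>A\<close>, their
  agreement for all \<open>E\<close> is the defining property of conditional expectation.
\<close>

lemma kernel_prod_eq_iff_cond_exp:
  assumes P: "prob_space P" and X[measurable]: "X \<in> P \<rightarrow>\<^sub>M \<X>" and V[measurable]: "V \<in> P \<rightarrow>\<^sub>M \<V>"
    and Q[measurable]: "markov_kernel \<V> \<X> Q" and L: "L t = distr P \<V> V"
  shows "distr P (\<X> \<Otimes>\<^sub>M \<V>) (\<lambda>\<omega>. (X \<omega>, V \<omega>)) = kernel_prod \<V> Q L t \<longleftrightarrow>
    (\<forall>A\<in>sets \<X>. AE \<omega> in P. real_cond_exp P (vimage_algebra (space P) V \<V>)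
      (\<lambda>\<omega>. indicator A (X \<omega>)) \<omega> = measure (Q (V \<omega>)) A)" (is "?J = ?N \<longleftrightarrow> ?R")
proof -
  interpret P: prob_space P by (rule P)
  have J: "prob_space ?J" by (rule P.prob_space_distr) simp
  have Lp: "L t \<in> space (prob_algebra \<V>)"
    unfolding L by (simp add: space_prob_algebra P.prob_space_distr)
  have N: "prob_space ?N" "sets ?N = sets (\<X> \<Otimes>\<^sub>M \<V>)"
    using kernel_prod_in_prob_algebra[where L = L and t = t, OF Q Lp] by (auto simp: space_prob_algebra)
  have Qp: "prob_space (Q (V \<omega>))" if "\<omega> \<in> space P" for \<omega>
    using kernel_at(3)[OF Q measurable_space[OF V that]] .
  have int_Q: "integrable P (\<lambda>\<omega>. measure (Q (V \<omega>)) A)" if [measurable]: "A \<in> sets \<X>" for A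
    by (rule P.integrable_const_bound[where B = 1])
       (auto intro!: AE_I2 prob_space.prob_le_1 Qp)
  have int_X: "integrable P (\<lambda>\<omega>. indicator A (X \<omega>) :: real)" if [measurable]: "A \<in> sets \<X>" for A
    by (rule P.integrable_const_bound[where B = 1]) auto
  have J_rect: "emeasure ?J (A \<times> E) = ennreal (\<integral>\<omega>\<in>V -` E \<inter> space P. indicator A (X \<omega>) \<partial>P)"
    if [measurable]: "A \<in> sets \<X>" "E \<in> sets \<V>" for A E
  proof -
    have "emeasure ?J (A \<times> E) = emeasure P ((X -` A \<inter> space P) \<inter> (V -` E \<inter> space P))"
      by (subst emeasure_distr) (auto intro!: arg_cong[where f = "emeasure P"])
    also have "\<dots> = ennreal (\<integral>\<omega>. indicator ((X -` A \<inter> space P) \<inter> (V -` E \<inter> space P)) \<omega> \<partial>P)"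
      by (simp add: P.emeasure_eq_measure)
    also have "(\<integral>\<omega>. indicator ((X -` A \<inter> space P) \<inter> (V -` E \<inter> space P)) \<omega> \<partial>P) =
        (\<integral>\<omega>\<in>V -` E \<inter> space P. indicator A (X \<omega>) \<partial>P)"
      unfolding set_lebesgue_integral_def
      by (rule Bochner_Integration.integral_cong) (auto simp: indicator_def)
    finally show ?thesis .
  qed
  have N_rect: "emeasure ?N (A \<times> E) = ennreal (\<integral>\<omega>\<in>V -` E \<inter> space P. measure (Q (V \<omega>)) A \<partial>P)"
    if A[measurable]: "A \<in> sets \<X>" and E[measurable]: "E \<in> sets \<V>" for A E
  proof -
    \<comment> \<open>A single law is a kernel from the one-point space.\<close>
    have Lm: "markov_kernel one_point \<V> (\<lambda>_. L t)"
      using Lp by simp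
    have "emeasure ?N (A \<times> E) = (\<integral>\<^sup>+v. indicator E v * emeasure (Q v) A \<partial>L t)"
      using emeasure_kernel_prod_Times[OF Q Lm, of "()" A E] A E by (simp add: kernel_prod_def)
    also have "\<dots> = (\<integral>\<^sup>+\<omega>. indicator E (V \<omega>) * emeasure (Q (V \<omega>)) A \<partial>P)"
      unfolding L by (rule nn_integral_distr) (use measurable_prob_algebraD[OF Q] in measurable)
    also have "\<dots> = (\<integral>\<^sup>+\<omega>. ennreal (indicator (V -` E \<inter> space P) \<omega> * measure (Q (V \<omega>)) A) \<partial>P)"
      by (intro nn_integral_cong)
         (auto simp: indicator_def finite_measure.emeasure_eq_measure[OF prob_space.finite_measure[OF Qp]])
    also have "\<dots> = ennreal (\<integral>\<omega>. indicator (V -` E \<inter> space P) \<omega> * measure (Q (V \<omega>)) A \<partial>P)"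
      by (rule nn_integral_eq_integral) (auto intro!: integrable_real_mult_indicator int_Q simp: mult.commute)
    finally show ?thesis by (simp add: set_lebesgue_integral_def)
  qed
  have "?J = ?N \<longleftrightarrow> (\<forall>A\<in>sets \<X>. \<forall>E\<in>sets \<V>. emeasure ?J (A \<times> E) = emeasure ?N (A \<times> E))"
    using prob_measure_eqI_Times[OF J N(1) _ N(2)] by auto
  also have "\<dots> \<longleftrightarrow> (\<forall>A\<in>sets \<X>. \<forall>E\<in>sets \<V>.
      (\<integral>\<omega>\<in>V -` E \<inter> space P. indicator A (X \<omega>) \<partial>P) =
      (\<integral>\<omega>\<in>V -` E \<inter> space P. measure (Q (V \<omega>)) A \<partial>P))"
    by (intro ball_cong refl)
       (simp add: J_rect N_rect ennreal_inj set_lebesgue_integral_def integral_nonneg_AE)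
  also have "\<dots> \<longleftrightarrow> ?R"
    by (intro ball_cong refl real_cond_exp_vimage_iff[OF P V, symmetric] int_X int_Q
        measurable_compose[OF Q measurable_measure_prob_algebra])
  finally show ?thesis .
qed

section \<open>Pushing a factorization forward\<close>

lemma kernel_tensor_kernel:
  assumes "markov_kernel M N X" "markov_kernel M L Y"
  shows "markov_kernel M (N \<Otimes>\<^sub>M L) (X \<otimes>\<^sub>K Y)"
proof -
  have "X \<otimes>\<^sub>K Y = (\<lambda>a. X a \<Otimes>\<^sub>M Y a)" by (simp add: kernel_tensor_def fun_eq_iff)
  then show ?thesis using assms by simp
qed

lemma joint_kernel_kernel:
  assumes K: "markov_kernel \<T> \<W> K" and U: "markov_kernel (\<W> \<Otimes>\<^sub>M \<T>) \<U> U"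
  shows "markov_kernel \<T> \<U> (joint_kernel K U)"
proof -
  note [measurable] = K U
  have "(\<lambda>t. K t \<bind> (\<lambda>w. U (w, t))) \<in> \<T> \<rightarrow>\<^sub>M prob_algebra \<U>" by measurable
  then show ?thesis by (simp add: joint_kernel_def[abs_def])
qed

text \<open>
  Drawing \<open>v\<close> and then \<open>x\<close> from \<open>Q (g v)\<close>, and afterwards replacing \<open>v\<close> by \<open>g v\<close>, is the same as
  drawing \<open>g v\<close> directly.
\<close>

lemma kernel_prod_distr:
  assumes Q: "markov_kernel \<V>' \<X> Q" and g[measurable]: "g \<in> \<V> \<rightarrow>\<^sub>M \<V>'"
    and L: "L t \<in> space (prob_algebra \<V>)"
    and Q': "\<And>v. v \<in> space \<V> \<Longrightarrow> Q' v = Q (g v)"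
  shows "distr (kernel_prod \<V> Q' L t) (\<X> \<Otimes>\<^sub>M \<V>') (\<lambda>(x, v). (x, g v)) =
    kernel_prod \<V>' Q (\<lambda>t. distr (L t) \<V>' g) t"
proof -
  have L': "sets (L t) = sets \<V>" "space (L t) = space \<V>" "space (L t) \<noteq> {}"
    using L prob_space.not_empty[of "L t"] by (auto simp: space_prob_algebra dest: sets_eq_imp_space_eq)
  have [measurable_cong]: "sets (L t) = sets \<V>" by (rule L')
  have Qg: "(\<lambda>v. Q (g v)) \<in> \<V> \<rightarrow>\<^sub>M prob_algebra \<X>"
    by (rule measurable_compose[OF g Q])
  have m: "(\<lambda>v. Q (g v) \<Otimes>\<^sub>M return \<V> v) \<in> L t \<rightarrow>\<^sub>M subprob_algebra (\<X> \<Otimes>\<^sub>M \<V>)"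
    using measurable_prob_algebraD[OF measurable_pair_prob[OF Qg measurable_return_prob_space]]
    by (simp add: L'(1) cong: measurable_cong_sets)
  have m': "(\<lambda>v. Q v \<Otimes>\<^sub>M return \<V>' v) \<in> \<V>' \<rightarrow>\<^sub>M subprob_algebra (\<X> \<Otimes>\<^sub>M \<V>')"
    by (rule measurable_prob_algebraD[OF measurable_pair_prob[OF Q measurable_return_prob_space]])
  have "kernel_prod \<V> Q' L t = L t \<bind> (\<lambda>v. Q (g v) \<Otimes>\<^sub>M return \<V> v)"
    unfolding kernel_prod_def by (rule bind_cong) (auto simp: Q' L')
  then have "distr (kernel_prod \<V> Q' L t) (\<X> \<Otimes>\<^sub>M \<V>') (\<lambda>(x, v). (x, g v)) =
      distr (L t \<bind> (\<lambda>v. Q (g v) \<Otimes>\<^sub>M return \<V> v)) (\<X> \<Otimes>\<^sub>M \<V>') (\<lambda>(x, v). (x, g v))"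
    by simp
  also have "\<dots> =
      L t \<bind> (\<lambda>v. distr (Q (g v) \<Otimes>\<^sub>M return \<V> v) (\<X> \<Otimes>\<^sub>M \<V>') (\<lambda>(x, v). (x, g v)))"
    by (rule distr_bind[where K = "\<X> \<Otimes>\<^sub>M \<V>", OF m L'(3)]) simp
  also have "\<dots> = L t \<bind> (\<lambda>v. Q (g v) \<Otimes>\<^sub>M return \<V>' (g v))"
  proof (rule bind_cong[OF refl])
    fix v assume "v \<in> space (L t)"
    then have v: "v \<in> space \<V>" by (simp add: L')
    show "distr (Q (g v) \<Otimes>\<^sub>M return \<V> v) (\<X> \<Otimes>\<^sub>M \<V>') (\<lambda>(x, v). (x, g v)) =
        Q (g v) \<Otimes>\<^sub>M return \<V>' (g v)"
      using kernel_at(1)[OF Q measurable_space[OF g v]]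
        distr_pair_measure_map[OF prob_space_return[OF v], of "Q (g v)" \<X> \<V> "\<lambda>x. x" \<X> g \<V>']
      by (simp add: distr_return[OF g v] distr_id2 g)
  qed
  also have "\<dots> = kernel_prod \<V>' Q (\<lambda>t. distr (L t) \<V>' g) t"
    unfolding kernel_prod_def by (rule bind_distr[OF _ m' L'(3), symmetric]) simp
  finally show ?thesis .
qed

lemma joint_kernel_distr:
  assumes K: "markov_kernel \<T> \<W> K" and U: "markov_kernel (\<W> \<Otimes>\<^sub>M \<T>) \<U> U" and t: "t \<in> space \<T>"
    and g: "g \<in> \<U> \<rightarrow>\<^sub>M \<U>'"
    and U': "\<And>w. w \<in> space \<W> \<Longrightarrow> U' (w, t) = distr (U (w, t)) \<U>' g"
  shows "joint_kernel K U' t = distr (joint_kernel K U t) \<U>' g"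
proof -
  note Kt = kernel_at[OF K t]
  note [measurable] = measurable_prob_algebraD[OF U] t
  have [measurable_cong]: "sets (K t) = sets \<W>" by (rule Kt)
  have "joint_kernel K U' t = K t \<bind> (\<lambda>w. distr (U (w, t)) \<U>' g)"
    unfolding joint_kernel_def by (rule bind_cong) (auto simp: U' Kt)
  also have "\<dots> = distr (joint_kernel K U t) \<U>' g"
    unfolding joint_kernel_def
    by (rule distr_bind[symmetric, where K = \<U>]) (use g prob_space.not_empty[OF Kt(3)] in auto)
  finally show ?thesis .
qed

text \<open>
  All passages between different second variables are instances of this: \<open>V'\<close> is obtained from
  \<open>V\<close> by a map \<open>g\<close>, and \<open>Q'\<close> sees its argument only through \<open>g\<close>. The map \<open>g\<close> may depend on \<open>t\<close>,
  since only one value of \<open>t\<close> occurs.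
\<close>

lemma factorization_push:
  assumes K: "markov_kernel \<T> \<W> K" and X: "markov_kernel (\<W> \<Otimes>\<^sub>M \<T>) \<X> X"
    and V: "markov_kernel (\<W> \<Otimes>\<^sub>M \<T>) \<V> V" and t: "t \<in> space \<T>"
    and Q: "markov_kernel \<V>' \<X> Q" and g[measurable]: "g \<in> \<V> \<rightarrow>\<^sub>M \<V>'"
    and V': "\<And>w. w \<in> space \<W> \<Longrightarrow> V' (w, t) = distr (V (w, t)) \<V>' g"
    and Q': "\<And>v. v \<in> space \<V> \<Longrightarrow> Q' v = Q (g v)"
    and fact: "joint_kernel K (X \<otimes>\<^sub>K V) t = kernel_prod \<V> Q' (joint_kernel K V) t"
  shows "joint_kernel K (X \<otimes>\<^sub>K V') t = kernel_prod \<V>' Q (joint_kernel K V') t"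
proof -
  have XV: "markov_kernel (\<W> \<Otimes>\<^sub>M \<T>) (\<X> \<Otimes>\<^sub>M \<V>) (X \<otimes>\<^sub>K V)"
    by (rule kernel_tensor_kernel[OF X V])
  have "joint_kernel K (X \<otimes>\<^sub>K V') t =
      distr (joint_kernel K (X \<otimes>\<^sub>K V) t) (\<X> \<Otimes>\<^sub>M \<V>') (\<lambda>(x, v). (x, g v))"
  proof (rule joint_kernel_distr[OF K XV t])
    fix w assume "w \<in> space \<W>"
    then have a: "(w, t) \<in> space (\<W> \<Otimes>\<^sub>M \<T>)" using t by (simp add: space_pair_measure)
    show "(X \<otimes>\<^sub>K V') (w, t) = distr ((X \<otimes>\<^sub>K V) (w, t)) (\<X> \<Otimes>\<^sub>M \<V>') (\<lambda>(x, v). (x, g v))"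
      using distr_pair_measure_map[OF kernel_at(3)[OF V a] kernel_at(1)[OF X a] kernel_at(1)[OF V a],
          of "\<lambda>x. x" \<X> g \<V>'] kernel_at(1)[OF X a]
      by (simp add: kernel_tensor_def V'[OF \<open>w \<in> space \<W>\<close>] distr_id2 g)
  qed simp
  also have "\<dots> = kernel_prod \<V>' Q (\<lambda>t. distr (joint_kernel K V t) \<V>' g) t"
    unfolding fact
    by (rule kernel_prod_distr[OF Q g _ Q']) (rule kernel_at(4)[OF joint_kernel_kernel[OF K V] t])
  also have "\<dots> = kernel_prod \<V>' Q (joint_kernel K V') t"
    by (simp add: kernel_prod_def joint_kernel_distr[OF K V t g V'])
  finally show ?thesis .
qed

section \<open>Changing the second variable\<close>

lemma factorizes2_of_factorizes3:
  assumes "markov_kernel \<T> \<W> K" "markov_kernel (\<W> \<Otimes>\<^sub>M \<T>) \<X> X"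
    and Y: "markov_kernel (\<W> \<Otimes>\<^sub>M \<T>) \<Y> Y" and Z: "markov_kernel (\<W> \<Otimes>\<^sub>M \<T>) \<Z> Z"
    and "markov_kernel \<Z> \<X> Q" and fact: "factorizes3 \<T> \<Y> \<Z> K X Y Z Q"
  shows "factorizes2 \<T> \<Z> K X Z Q"
  unfolding factorizes2_def
proof
  fix t assume t: "t \<in> space \<T>"
  show "joint_kernel K (X \<otimes>\<^sub>K Z) t = kernel_prod \<Z> Q (joint_kernel K Z) t"
  proof (rule factorization_push[OF assms(1,2) kernel_tensor_kernel[OF Y Z] t assms(5) measurable_snd])
    show "joint_kernel K (X \<otimes>\<^sub>K Y \<otimes>\<^sub>K Z) t =
        kernel_prod (\<Y> \<Otimes>\<^sub>M \<Z>) (\<lambda>(y, z). Q z) (joint_kernel K (Y \<otimes>\<^sub>K Z)) t"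
      using fact t by (simp add: factorizes3_def)
    fix w assume "w \<in> space \<W>"
    then have a: "(w, t) \<in> space (\<W> \<Otimes>\<^sub>M \<T>)" using t by (simp add: space_pair_measure)
    show "Z (w, t) = distr ((Y \<otimes>\<^sub>K Z) (w, t)) \<Z> snd"
      using distr_snd_pair_measure[OF kernel_at(3)[OF Y a] kernel_at(3,1)[OF Z a]]
      by (simp add: kernel_tensor_def)
  qed auto
qed

text \<open>
  The left-hand side is literally about laws on \<open>\<X> \<times> {*} \<times> \<Z>\<close>; the constant component is dropped by
  \<open>snd\<close> and restored by \<open>Pair ()\<close>.
\<close>

lemma factorizes3_star_iff:
  assumes K: "markov_kernel \<T> \<W> K" and X: "markov_kernel (\<W> \<Otimes>\<^sub>M \<T>) \<X> X"
    and Z: "markov_kernel (\<W> \<Otimes>\<^sub>M \<T>) \<Z> Z" and Q: "markov_kernel \<Z> \<X> Q"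
  shows "factorizes3 \<T> one_point \<Z> K X star_kernel Z Q \<longleftrightarrow> factorizes2 \<T> \<Z> K X Z Q"
proof
  have S: "markov_kernel (\<W> \<Otimes>\<^sub>M \<T>) one_point star_kernel"
    unfolding star_kernel_def
    by (rule measurable_const) (simp add: space_prob_algebra prob_space_return)
  show "factorizes2 \<T> \<Z> K X Z Q" if "factorizes3 \<T> one_point \<Z> K X star_kernel Z Q"
    by (rule factorizes2_of_factorizes3[OF K X S Z Q that])
  assume fact: "factorizes2 \<T> \<Z> K X Z Q"
  show "factorizes3 \<T> one_point \<Z> K X star_kernel Z Q"
    unfolding factorizes3_def
  proof
    fix t assume t: "t \<in> space \<T>"
    have Q': "markov_kernel (one_point \<Otimes>\<^sub>M \<Z>) \<X> (\<lambda>(y, z). Q z)"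
      using Q by measurable
    show "joint_kernel K (X \<otimes>\<^sub>K star_kernel \<otimes>\<^sub>K Z) t =
        kernel_prod (one_point \<Otimes>\<^sub>M \<Z>) (\<lambda>(y, z). Q z) (joint_kernel K (star_kernel \<otimes>\<^sub>K Z)) t"
    proof (rule factorization_push[OF K X Z t Q', where g = "Pair ()" and Q' = Q])
      show "joint_kernel K (X \<otimes>\<^sub>K Z) t = kernel_prod \<Z> Q (joint_kernel K Z) t"
        using fact t by (simp add: factorizes2_def)
      fix w assume "w \<in> space \<W>"
      then have a: "(w, t) \<in> space (\<W> \<Otimes>\<^sub>M \<T>)" using t by (simp add: space_pair_measure)
      have "sets (one_point \<Otimes>\<^sub>M Z (w, t)) = sets (one_point \<Otimes>\<^sub>M \<Z>)"
        using kernel_at(1)[OF Z a] by (rule sets_pair_measure_cong[OF refl])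
      then show "(star_kernel \<otimes>\<^sub>K Z) (w, t) = distr (Z (w, t)) (one_point \<Otimes>\<^sub>M \<Z>) (Pair ())"
        using return_pair_measure[of "()" one_point "Z (w, t)"] kernel_at(3)[OF Z a]
        by (simp add: kernel_tensor_def star_kernel_def cong: distr_cong)
    qed simp_all
  qed
qed

text \<open>
  Processing \<open>Y\<close> by a measurable map preserves the factorization with the same \<open>Q\<close>, as \<open>Q\<close> depends
  on \<open>(y, z)\<close> through \<open>z\<close> alone.
\<close>

lemma factorizes3_processing:
  assumes K: "markov_kernel \<T> \<W> K" and X: "markov_kernel (\<W> \<Otimes>\<^sub>M \<T>) \<X> X"
    and Y: "markov_kernel (\<W> \<Otimes>\<^sub>M \<T>) \<Y> Y" and Z: "markov_kernel (\<W> \<Otimes>\<^sub>M \<T>) \<Z> Z"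
    and Q: "markov_kernel \<Z> \<X> Q"
    and h: "\<And>t. t \<in> space \<T> \<Longrightarrow> h t \<in> \<Y> \<rightarrow>\<^sub>M \<Y>'"
    and Y': "\<And>w t. w \<in> space \<W> \<Longrightarrow> t \<in> space \<T> \<Longrightarrow> Y' (w, t) = distr (Y (w, t)) \<Y>' (h t)"
    and fact: "factorizes3 \<T> \<Y> \<Z> K X Y Z Q"
  shows "factorizes3 \<T> \<Y>' \<Z> K X Y' Z Q"
  unfolding factorizes3_def
proof
  fix t assume t: "t \<in> space \<T>"
  note [measurable] = h[OF t] Q
  have Q': "markov_kernel (\<Y>' \<Otimes>\<^sub>M \<Z>) \<X> (\<lambda>(y, z). Q z)"
    by measurable
  show "joint_kernel K (X \<otimes>\<^sub>K Y' \<otimes>\<^sub>K Z) t =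
      kernel_prod (\<Y>' \<Otimes>\<^sub>M \<Z>) (\<lambda>(y, z). Q z) (joint_kernel K (Y' \<otimes>\<^sub>K Z)) t"
  proof (rule factorization_push[OF K X kernel_tensor_kernel[OF Y Z] t Q',
        where g = "\<lambda>(y, z). (h t y, z)" and Q' = "\<lambda>(y, z). Q z"])
    show "joint_kernel K (X \<otimes>\<^sub>K Y \<otimes>\<^sub>K Z) t =
        kernel_prod (\<Y> \<Otimes>\<^sub>M \<Z>) (\<lambda>(y, z). Q z) (joint_kernel K (Y \<otimes>\<^sub>K Z)) t"
      using fact t by (simp add: factorizes3_def)
    fix w assume w: "w \<in> space \<W>"
    then have a: "(w, t) \<in> space (\<W> \<Otimes>\<^sub>M \<T>)" using t by (simp add: space_pair_measure)
    show "(Y' \<otimes>\<^sub>K Z) (w, t) = distr ((Y \<otimes>\<^sub>K Z) (w, t)) (\<Y>' \<Otimes>\<^sub>M \<Z>) (\<lambda>(y, z). (h t y, z))"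
      using distr_pair_measure_map[OF kernel_at(3)[OF Z a] kernel_at(1)[OF Y a] kernel_at(1)[OF Z a],
          of "h t" \<Y>' "\<lambda>z. z" \<Z>] kernel_at(1)[OF Z a]
      by (simp add: kernel_tensor_def Y'[OF w t] h[OF t] distr_id2)
  qed auto
qed

lemma param_kernel_kernel: "markov_kernel (\<W> \<Otimes>\<^sub>M \<T>) \<T> (param_kernel \<T>)"
  unfolding param_kernel_def by measurable

text \<open>
  For fixed \<open>t\<close>, the parameter is a constant: \<open>T \<otimes> Y\<close> is the image of \<open>Y\<close> under \<open>y \<mapsto> (t, y)\<close>, and
  \<open>Y\<close> is the image of \<open>T \<otimes> Y\<close> under \<open>snd\<close>.
\<close>

lemma factorizes3_param_iff:
  assumes K: "markov_kernel \<T> \<W> K" and X: "markov_kernel (\<W> \<Otimes>\<^sub>M \<T>) \<X> X"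
    and Y: "markov_kernel (\<W> \<Otimes>\<^sub>M \<T>) \<Y> Y" and Z: "markov_kernel (\<W> \<Otimes>\<^sub>M \<T>) \<Z> Z"
    and Q: "markov_kernel \<Z> \<X> Q"
  shows "factorizes3 \<T> (\<T> \<Otimes>\<^sub>M \<Y>) \<Z> K X (param_kernel \<T> \<otimes>\<^sub>K Y) Z Q \<longleftrightarrow> factorizes3 \<T> \<Y> \<Z> K X Y Z Q"
proof
  assume "factorizes3 \<T> \<Y> \<Z> K X Y Z Q"
  then show "factorizes3 \<T> (\<T> \<Otimes>\<^sub>M \<Y>) \<Z> K X (param_kernel \<T> \<otimes>\<^sub>K Y) Z Q"
  proof (rule factorizes3_processing[OF K X Y Z Q, where h = Pair, rotated 2])
    fix w t assume w: "w \<in> space \<W>" and t: "t \<in> space \<T>"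
    then have a: "(w, t) \<in> space (\<W> \<Otimes>\<^sub>M \<T>)" by (simp add: space_pair_measure)
    have "sets (\<T> \<Otimes>\<^sub>M Y (w, t)) = sets (\<T> \<Otimes>\<^sub>M \<Y>)"
      using kernel_at(1)[OF Y a] by (rule sets_pair_measure_cong[OF refl])
    then show "(param_kernel \<T> \<otimes>\<^sub>K Y) (w, t) = distr (Y (w, t)) (\<T> \<Otimes>\<^sub>M \<Y>) (Pair t)"
      using return_pair_measure[OF t kernel_at(3)[OF Y a]]
      by (simp add: kernel_tensor_def param_kernel_def cong: distr_cong)
  qed simp
next
  assume "factorizes3 \<T> (\<T> \<Otimes>\<^sub>M \<Y>) \<Z> K X (param_kernel \<T> \<otimes>\<^sub>K Y) Z Q"
  then show "factorizes3 \<T> \<Y> \<Z> K X Y Z Q"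
  proof (rule factorizes3_processing[OF K X kernel_tensor_kernel[OF param_kernel_kernel Y] Z Q,
        where h = "\<lambda>_. snd", rotated 2])
    fix w t assume w: "w \<in> space \<W>" and t: "t \<in> space \<T>"
    then have a: "(w, t) \<in> space (\<W> \<Otimes>\<^sub>M \<T>)" by (simp add: space_pair_measure)
    show "Y (w, t) = distr ((param_kernel \<T> \<otimes>\<^sub>K Y) (w, t)) \<Y> snd"
      using distr_snd_pair_measure[OF kernel_at(3)[OF param_kernel_kernel a] kernel_at(3,1)[OF Y a]]
      by (simp add: kernel_tensor_def)
  qed simp
qed

section \<open>Factorizations as conditional expectations\<close>

text \<open>
  The joint law of \<open>(X, Y, Z)\<close> serves as the probability space, with its coordinates as random
  variables, so that the conditional expectations are those of weak conditional independence.
\<close>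

lemma factorizes3_iff_cond_exp:
  assumes K: "markov_kernel \<T> \<W> K" and X: "markov_kernel (\<W> \<Otimes>\<^sub>M \<T>) \<X> X"
    and Y: "markov_kernel (\<W> \<Otimes>\<^sub>M \<T>) \<Y> Y" and Z: "markov_kernel (\<W> \<Otimes>\<^sub>M \<T>) \<Z> Z"
    and Q: "markov_kernel \<Z> \<X> Q"
  shows "factorizes3 \<T> \<Y> \<Z> K X Y Z Q \<longleftrightarrow>
    (\<forall>t\<in>space \<T>. \<forall>A\<in>sets \<X>. let P = joint_kernel K (X \<otimes>\<^sub>K Y \<otimes>\<^sub>K Z) t in
      AE \<omega> in P. real_cond_exp P (vimage_algebra (space P) snd (\<Y> \<Otimes>\<^sub>M \<Z>))
        (\<lambda>\<omega>. indicator A (fst \<omega>)) \<omega> = measure (Q (snd (snd \<omega>))) A)"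
  unfolding factorizes3_def Let_def
proof (rule ball_cong[OF refl])
  fix t assume t: "t \<in> space \<T>"
  let ?P = "joint_kernel K (X \<otimes>\<^sub>K Y \<otimes>\<^sub>K Z) t"
  have YZ: "markov_kernel (\<W> \<Otimes>\<^sub>M \<T>) (\<Y> \<Otimes>\<^sub>M \<Z>) (Y \<otimes>\<^sub>K Z)"
    by (rule kernel_tensor_kernel[OF Y Z])
  have XYZ: "markov_kernel (\<W> \<Otimes>\<^sub>M \<T>) (\<X> \<Otimes>\<^sub>M \<Y> \<Otimes>\<^sub>M \<Z>) (X \<otimes>\<^sub>K Y \<otimes>\<^sub>K Z)"
    by (rule kernel_tensor_kernel[OF X YZ])
  note P = kernel_at[OF joint_kernel_kernel[OF K XYZ] t]
  have [measurable_cong]: "sets ?P = sets (\<X> \<Otimes>\<^sub>M \<Y> \<Otimes>\<^sub>M \<Z>)" by (rule P)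
  have Q': "markov_kernel (\<Y> \<Otimes>\<^sub>M \<Z>) \<X> (\<lambda>(y, z). Q z)"
    using Q by measurable
  have L: "joint_kernel K (Y \<otimes>\<^sub>K Z) t = distr ?P (\<Y> \<Otimes>\<^sub>M \<Z>) snd"
  proof (rule joint_kernel_distr[OF K XYZ t measurable_snd])
    fix w assume "w \<in> space \<W>"
    then have a: "(w, t) \<in> space (\<W> \<Otimes>\<^sub>M \<T>)" using t by (simp add: space_pair_measure)
    show "(Y \<otimes>\<^sub>K Z) (w, t) = distr ((X \<otimes>\<^sub>K Y \<otimes>\<^sub>K Z) (w, t)) (\<Y> \<Otimes>\<^sub>M \<Z>) snd"
      using distr_snd_pair_measure[OF kernel_at(3)[OF X a] kernel_at(3,1)[OF YZ a]]
      by (simp add: kernel_tensor_def)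
  qed
  have "distr ?P (\<X> \<Otimes>\<^sub>M \<Y> \<Otimes>\<^sub>M \<Z>) (\<lambda>\<omega>. (fst \<omega>, snd \<omega>)) = ?P"
    using P(1) by (simp add: distr_id2)
  then show "?P = kernel_prod (\<Y> \<Otimes>\<^sub>M \<Z>) (\<lambda>(y, z). Q z) (joint_kernel K (Y \<otimes>\<^sub>K Z)) t \<longleftrightarrow>
    (\<forall>A\<in>sets \<X>. AE \<omega> in ?P. real_cond_exp ?P (vimage_algebra (space ?P) snd (\<Y> \<Otimes>\<^sub>M \<Z>))
        (\<lambda>\<omega>. indicator A (fst \<omega>)) \<omega> = measure (Q (snd (snd \<omega>))) A)"
    using kernel_prod_eq_iff_cond_exp[where L = "joint_kernel K (Y \<otimes>\<^sub>K Z)" and t = t,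
        OF P(3) _ _ Q' L, of fst]
    by (simp add: case_prod_beta)
qed

text \<open>
  The equation involves only \<open>(X, Z)\<close>, but it is read on the law of \<open>(X, Y, Z)\<close>, so that the
  conditional expectation given \<open>Z\<close> lives on the same space as the one given \<open>(Y, Z)\<close>.
\<close>

lemma factorizes2_iff_cond_exp:
  assumes K: "markov_kernel \<T> \<W> K" and X: "markov_kernel (\<W> \<Otimes>\<^sub>M \<T>) \<X> X"
    and Y: "markov_kernel (\<W> \<Otimes>\<^sub>M \<T>) \<Y> Y" and Z: "markov_kernel (\<W> \<Otimes>\<^sub>M \<T>) \<Z> Z"
    and Q: "markov_kernel \<Z> \<X> Q"
  shows "factorizes2 \<T> \<Z> K X Z Q \<longleftrightarrow>
    (\<forall>t\<in>space \<T>. \<forall>A\<in>sets \<X>. let P = joint_kernel K (X \<otimes>\<^sub>K Y \<otimes>\<^sub>K Z) t in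
      AE \<omega> in P. real_cond_exp P (vimage_algebra (space P) (\<lambda>\<omega>. snd (snd \<omega>)) \<Z>)
        (\<lambda>\<omega>. indicator A (fst \<omega>)) \<omega> = measure (Q (snd (snd \<omega>))) A)"
  unfolding factorizes2_def Let_def
proof (rule ball_cong[OF refl])
  fix t assume t: "t \<in> space \<T>"
  let ?P = "joint_kernel K (X \<otimes>\<^sub>K Y \<otimes>\<^sub>K Z) t"
  have YZ: "markov_kernel (\<W> \<Otimes>\<^sub>M \<T>) (\<Y> \<Otimes>\<^sub>M \<Z>) (Y \<otimes>\<^sub>K Z)"
    by (rule kernel_tensor_kernel[OF Y Z])
  have XYZ: "markov_kernel (\<W> \<Otimes>\<^sub>M \<T>) (\<X> \<Otimes>\<^sub>M \<Y> \<Otimes>\<^sub>M \<Z>) (X \<otimes>\<^sub>K Y \<otimes>\<^sub>K Z)"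
    by (rule kernel_tensor_kernel[OF X YZ])
  note P = kernel_at[OF joint_kernel_kernel[OF K XYZ] t]
  have [measurable_cong]: "sets ?P = sets (\<X> \<Otimes>\<^sub>M \<Y> \<Otimes>\<^sub>M \<Z>)" by (rule P)
  have dZ: "Z (w, t) = distr ((Y \<otimes>\<^sub>K Z) (w, t)) \<Z> snd"
    and dYZ: "(Y \<otimes>\<^sub>K Z) (w, t) = distr ((X \<otimes>\<^sub>K Y \<otimes>\<^sub>K Z) (w, t)) (\<Y> \<Otimes>\<^sub>M \<Z>) snd"
    and dXZ: "(X \<otimes>\<^sub>K Z) (w, t) =
      distr ((X \<otimes>\<^sub>K Y \<otimes>\<^sub>K Z) (w, t)) (\<X> \<Otimes>\<^sub>M \<Z>) (\<lambda>(x, v). (x, snd v))"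
    if w: "w \<in> space \<W>" for w
  proof -
    have a: "(w, t) \<in> space (\<W> \<Otimes>\<^sub>M \<T>)" using t w by (simp add: space_pair_measure)
    show Z': "Z (w, t) = distr ((Y \<otimes>\<^sub>K Z) (w, t)) \<Z> snd"
      using distr_snd_pair_measure[OF kernel_at(3)[OF Y a] kernel_at(3,1)[OF Z a]]
      by (simp add: kernel_tensor_def)
    show "(Y \<otimes>\<^sub>K Z) (w, t) = distr ((X \<otimes>\<^sub>K Y \<otimes>\<^sub>K Z) (w, t)) (\<Y> \<Otimes>\<^sub>M \<Z>) snd"
      using distr_snd_pair_measure[OF kernel_at(3)[OF X a] kernel_at(3,1)[OF YZ a]]
      by (simp add: kernel_tensor_def)
    have "(X \<otimes>\<^sub>K Z) (w, t) = X (w, t) \<Otimes>\<^sub>M distr ((Y \<otimes>\<^sub>K Z) (w, t)) \<Z> snd"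
      using Z' by (simp add: kernel_tensor_def)
    also have "\<dots> = distr (X (w, t) \<Otimes>\<^sub>M (Y \<otimes>\<^sub>K Z) (w, t)) (\<X> \<Otimes>\<^sub>M \<Z>) (\<lambda>(x, v). (x, snd v))"
      using distr_pair_measure_map[OF kernel_at(3)[OF YZ a] kernel_at(1)[OF X a] kernel_at(1)[OF YZ a],
          of "\<lambda>x. x" \<X> snd \<Z>] kernel_at(1)[OF X a]
      by (simp add: distr_id2)
    finally show "(X \<otimes>\<^sub>K Z) (w, t) =
      distr ((X \<otimes>\<^sub>K Y \<otimes>\<^sub>K Z) (w, t)) (\<X> \<Otimes>\<^sub>M \<Z>) (\<lambda>(x, v). (x, snd v))"
      by (simp add: kernel_tensor_def)
  qed
  have L: "joint_kernel K Z t = distr ?P \<Z> (\<lambda>\<omega>. snd (snd \<omega>))"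
  proof (rule joint_kernel_distr[OF K XYZ t])
    fix w assume w: "w \<in> space \<W>"
    then have "(w, t) \<in> space (\<W> \<Otimes>\<^sub>M \<T>)" using t by (simp add: space_pair_measure)
    from kernel_at(1)[OF XYZ this]
    have "snd \<in> (X \<otimes>\<^sub>K Y \<otimes>\<^sub>K Z) (w, t) \<rightarrow>\<^sub>M \<Y> \<Otimes>\<^sub>M \<Z>"
      by (simp cong: measurable_cong_sets)
    then show "Z (w, t) = distr ((X \<otimes>\<^sub>K Y \<otimes>\<^sub>K Z) (w, t)) \<Z> (\<lambda>\<omega>. snd (snd \<omega>))"
      using dZ[OF w] dYZ[OF w] distr_distr[of snd "\<Y> \<Otimes>\<^sub>M \<Z>" \<Z> snd "(X \<otimes>\<^sub>K Y \<otimes>\<^sub>K Z) (w, t)"]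
      by (simp add: comp_def)
  qed simp
  have "joint_kernel K (X \<otimes>\<^sub>K Z) t = distr ?P (\<X> \<Otimes>\<^sub>M \<Z>) (\<lambda>\<omega>. (fst \<omega>, snd (snd \<omega>)))"
    using joint_kernel_distr[OF K XYZ t _ dXZ] by (simp add: case_prod_beta')
  then show "joint_kernel K (X \<otimes>\<^sub>K Z) t = kernel_prod \<Z> Q (joint_kernel K Z) t \<longleftrightarrow>
    (\<forall>A\<in>sets \<X>. AE \<omega> in ?P. real_cond_exp ?P (vimage_algebra (space ?P) (\<lambda>\<omega>. snd (snd \<omega>)) \<Z>)
        (\<lambda>\<omega>. indicator A (fst \<omega>)) \<omega> = measure (Q (snd (snd \<omega>))) A)"
    using kernel_prod_eq_iff_cond_exp[where L = "joint_kernel K Z" and t = t, OF P(3) _ _ Q L, of fst]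
    by simp
qed

lemma weak_cond_indep_projections:
  "weak_cond_indep P \<X> \<Y> \<Z> (\<lambda>(x, y, z). x) (\<lambda>(x, y, z). y) (\<lambda>(x, y, z). z) \<longleftrightarrow>
    (\<forall>A\<in>sets \<X>. AE \<omega> in P.
      real_cond_exp P (vimage_algebra (space P) snd (\<Y> \<Otimes>\<^sub>M \<Z>)) (\<lambda>\<omega>. indicator A (fst \<omega>)) \<omega> =
      real_cond_exp P (vimage_algebra (space P) (\<lambda>\<omega>. snd (snd \<omega>)) \<Z>) (\<lambda>\<omega>. indicator A (fst \<omega>)) \<omega>)"
  by (simp add: weak_cond_indep_def case_prod_beta')

text \<open>
  Here the kernel drops out: by the hypothesis \<open>Q(A | Z)\<close> is almost surely the conditional
  expectation given \<open>Z\<close>, so it may be replaced by the latter in the characterization of the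
  left-hand side.
\<close>

lemma factorizes3_iff_weak_cond_indep:
  assumes K: "markov_kernel \<T> \<W> K" and X: "markov_kernel (\<W> \<Otimes>\<^sub>M \<T>) \<X> X"
    and Y: "markov_kernel (\<W> \<Otimes>\<^sub>M \<T>) \<Y> Y" and Z: "markov_kernel (\<W> \<Otimes>\<^sub>M \<T>) \<Z> Z"
    and Q: "markov_kernel \<Z> \<X> Q" and fact2: "factorizes2 \<T> \<Z> K X Z Q"
  shows "factorizes3 \<T> \<Y> \<Z> K X Y Z Q \<longleftrightarrow>
    (\<forall>t\<in>space \<T>. weak_cond_indep (joint_kernel K (X \<otimes>\<^sub>K Y \<otimes>\<^sub>K Z) t) \<X> \<Y> \<Z>
       (\<lambda>(x, y, z). x) (\<lambda>(x, y, z). y) (\<lambda>(x, y, z). z))"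
proof -
  have AE_eq_cong: "(AE \<omega> in P. u \<omega> = v \<omega>) \<longleftrightarrow> (AE \<omega> in P. u \<omega> = v' \<omega>)"
    if "AE \<omega> in P. v' \<omega> = v \<omega>" for P :: "('x \<times> 'y \<times> 'z) measure" and u v v' :: "_ \<Rightarrow> real"
    using that by (intro eventually_subst) (auto elim: eventually_mono)
  show ?thesis
    unfolding factorizes3_iff_cond_exp[OF K X Y Z Q] weak_cond_indep_projections Let_def
    using fact2[unfolded factorizes2_iff_cond_exp[OF K X Y Z Q] Let_def]
    by (intro ball_cong refl AE_eq_cong) auto
qed

section \<open>Mixing over the parameter\<close>

text \<open>
  Drawing \<open>(w, t)\<close> from \<open>K(W | T) \<otimes> \<mu>(T)\<close> and then \<open>u\<close> from \<open>U (w, t)\<close> is drawing \<open>t\<close> from \<open>\<mu>\<close> and then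
  \<open>u\<close> from \<open>K(U | T = t)\<close>: associativity of bind.
\<close>

lemma joint_kernel_mixture:
  assumes K: "markov_kernel \<T> \<W> K" and U: "markov_kernel (\<W> \<Otimes>\<^sub>M \<T>) \<U> U"
    and \<mu>: "sets \<mu> = sets \<T>"
  shows "joint_kernel (mixture_kernel \<T> K \<mu>) (lift_rv U) () = \<mu> \<bind> joint_kernel K U"
proof -
  note [measurable] = measurable_prob_algebraD[OF U]
  have m: "(\<lambda>t. K t \<Otimes>\<^sub>M return \<T> t) \<in> \<mu> \<rightarrow>\<^sub>M subprob_algebra (\<W> \<Otimes>\<^sub>M \<T>)"
    using measurable_prob_algebraD[OF measurable_pair_prob[OF K measurable_return_prob_space]]
    by (simp add: \<mu> cong: measurable_cong_sets)
  have "joint_kernel (mixture_kernel \<T> K \<mu>) (lift_rv U) () =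
      (\<mu> \<bind> (\<lambda>t. K t \<Otimes>\<^sub>M return \<T> t)) \<bind> U"
    by (simp add: joint_kernel_def mixture_kernel_def kernel_prod_def lift_rv_def)
  also have "\<dots> = \<mu> \<bind> (\<lambda>t. (K t \<Otimes>\<^sub>M return \<T> t) \<bind> U)"
    by (rule bind_assoc[OF m measurable_prob_algebraD[OF U]])
  also have "\<dots> = \<mu> \<bind> joint_kernel K U"
  proof (rule bind_cong[OF refl])
    fix t assume "t \<in> space \<mu>"
    then have t: "t \<in> space \<T>" using sets_eq_imp_space_eq[OF \<mu>] by simp
    note Kt = kernel_at[OF K t]
    have [measurable_cong]: "sets (K t) = sets \<W>" by (rule Kt)
    have "K t \<Otimes>\<^sub>M return \<T> t = distr (K t) (\<W> \<Otimes>\<^sub>M \<T>) (\<lambda>w. (w, t))"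
      unfolding pair_measure_return[OF t Kt(3)]
      by (rule distr_cong) (auto simp: Kt cong: sets_pair_measure_cong)
    then show "(K t \<Otimes>\<^sub>M return \<T> t) \<bind> U = joint_kernel K U t"
      unfolding joint_kernel_def using t prob_space.not_empty[OF Kt(3)]
      by (simp add: bind_distr[where K = \<U>])
  qed
  finally show ?thesis .
qed

lemma lift_rv_tensor: "lift_rv U \<otimes>\<^sub>K lift_rv V = lift_rv (U \<otimes>\<^sub>K V)"
  by (auto simp: lift_rv_def kernel_tensor_def fun_eq_iff)

text \<open>
  Both sides of the factorization are integrated against \<open>\<mu>\<close>; on the right-hand side the integral
  moves inside the kernel product, again by associativity of bind.
\<close>

lemma factorizes3_mixture:
  assumes K: "markov_kernel \<T> \<W> K" and X: "markov_kernel (\<W> \<Otimes>\<^sub>M \<T>) \<X> X"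
    and Y: "markov_kernel (\<W> \<Otimes>\<^sub>M \<T>) \<Y> Y" and Z: "markov_kernel (\<W> \<Otimes>\<^sub>M \<T>) \<Z> Z"
    and Q: "markov_kernel \<Z> \<X> Q" and \<mu>: "sets \<mu> = sets \<T>"
    and fact: "factorizes3 \<T> \<Y> \<Z> K X Y Z Q"
  shows "factorizes3 one_point \<Y> \<Z> (mixture_kernel \<T> K \<mu>) (lift_rv X) (lift_rv Y) (lift_rv Z) Q"
proof -
  have YZ: "markov_kernel (\<W> \<Otimes>\<^sub>M \<T>) (\<Y> \<Otimes>\<^sub>M \<Z>) (Y \<otimes>\<^sub>K Z)"
    by (rule kernel_tensor_kernel[OF Y Z])
  let ?f = "\<lambda>v. (\<lambda>(y, z). Q z) v \<Otimes>\<^sub>M return (\<Y> \<Otimes>\<^sub>M \<Z>) v"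
  have Q': "markov_kernel (\<Y> \<Otimes>\<^sub>M \<Z>) \<X> (\<lambda>(y, z). Q z)"
    using Q by measurable
  have f: "?f \<in> \<Y> \<Otimes>\<^sub>M \<Z> \<rightarrow>\<^sub>M subprob_algebra (\<X> \<Otimes>\<^sub>M \<Y> \<Otimes>\<^sub>M \<Z>)"
    by (rule measurable_prob_algebraD[OF measurable_pair_prob[OF Q' measurable_return_prob_space]])
  have J: "joint_kernel K (Y \<otimes>\<^sub>K Z) \<in> \<mu> \<rightarrow>\<^sub>M subprob_algebra (\<Y> \<Otimes>\<^sub>M \<Z>)"
    using measurable_prob_algebraD[OF joint_kernel_kernel[OF K YZ]] \<mu>
    by (simp cong: measurable_cong_sets)
  have "\<mu> \<bind> joint_kernel K (X \<otimes>\<^sub>K Y \<otimes>\<^sub>K Z) = \<mu> \<bind> (\<lambda>t. joint_kernel K (Y \<otimes>\<^sub>K Z) t \<bind> ?f)"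
    using fact sets_eq_imp_space_eq[OF \<mu>]
    by (intro bind_cong) (auto simp: factorizes3_def kernel_prod_def)
  also have "\<dots> = (\<mu> \<bind> joint_kernel K (Y \<otimes>\<^sub>K Z)) \<bind> ?f"
    by (rule bind_assoc[OF J f, symmetric])
  finally show ?thesis
    by (simp add: factorizes3_def kernel_prod_def lift_rv_tensor
        joint_kernel_mixture[OF K kernel_tensor_kernel[OF X YZ] \<mu>] joint_kernel_mixture[OF K YZ \<mu>])
qed

section \<open>Equivalence of the notions of conditional independence\<close>

theorem theoremJ8:
  fixes \<W> :: "'w measure" and \<T> :: "'t measure"
    and \<X> :: "'x measure" and \<Y> :: "'y measure" and \<Z> :: "'z measure"
    and K :: "'t \<Rightarrow> 'w measure"
    and X :: "'w \<times> 't \<Rightarrow> 'x measure" and Y :: "'w \<times> 't \<Rightarrow> 'y measure"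
    and Z :: "'w \<times> 't \<Rightarrow> 'z measure"
  assumes "markov_kernel \<T> \<W> K"
    and "markov_kernel (\<W> \<Otimes>\<^sub>M \<T>) \<X> X"
    and "markov_kernel (\<W> \<Otimes>\<^sub>M \<T>) \<Y> Y"
    and "markov_kernel (\<W> \<Otimes>\<^sub>M \<T>) \<Z> Z"
  shows
   "let
      c1 = trans_cond_indep \<T> \<X> \<Y> \<Z> K X Y Z;
      c2 = trans_cond_indep \<T> \<X> (\<T> \<Otimes>\<^sub>M \<Y>) \<Z> K X (param_kernel \<T> \<otimes>\<^sub>K Y) Z;
      c3 = (trans_cond_indep \<T> \<X> one_point \<Z> K X star_kernel Z \<and>
            (\<forall>R. markov_kernel \<Z> \<X> R \<and> factorizes2 \<T> \<Z> K X Z R \<longrightarrow>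
                 factorizes3 \<T> \<Y> \<Z> K X Y Z R));
      c4 = (star_below \<T> \<X> \<Z> K X Z \<and>
            (\<forall>t\<in>space \<T>. weak_cond_indep (joint_kernel K (X \<otimes>\<^sub>K Y \<otimes>\<^sub>K Z) t) \<X> \<Y> \<Z>
               (\<lambda>(x, y, z). x) (\<lambda>(x, y, z). y) (\<lambda>(x, y, z). z)));
      c5 = (\<forall>Q. prob_space Q \<and> sets Q = sets \<T> \<longrightarrow>
            trans_cond_indep one_point \<X> (\<T> \<Otimes>\<^sub>M \<Y>) \<Z> (mixture_kernel \<T> K Q)
              (lift_rv X) (lift_rv (param_kernel \<T>) \<otimes>\<^sub>K lift_rv Y) (lift_rv Z))
    in
      (c1 \<longleftrightarrow> c2) \<and> (c1 \<longleftrightarrow> c3) \<and> (c1 \<longleftrightarrow> c4) \<and>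
      (\<forall>R R'. markov_kernel \<Z> \<X> R \<and> factorizes2 \<T> \<Z> K X Z R \<and>
              markov_kernel \<Z> \<X> R' \<and> factorizes2 \<T> \<Z> K X Z R' \<longrightarrow>
              (factorizes3 \<T> \<Y> \<Z> K X Y Z R \<longleftrightarrow> factorizes3 \<T> \<Y> \<Z> K X Y Z R')) \<and>
      (c1 \<or> c2 \<or> c3 \<or> c4 \<longrightarrow> c5)"
proof -
  note K = assms(1) and X = assms(2) and Y = assms(3) and Z = assms(4)
  let ?f3 = "factorizes3 \<T> \<Y> \<Z> K X Y Z" and ?f2 = "factorizes2 \<T> \<Z> K X Z"
  let ?ker = "markov_kernel \<Z> \<X>"
  define wci where "wci \<longleftrightarrow>
    (\<forall>t\<in>space \<T>. weak_cond_indep (joint_kernel K (X \<otimes>\<^sub>K Y \<otimes>\<^sub>K Z) t) \<X> \<Y> \<Z>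
       (\<lambda>(x, y, z). x) (\<lambda>(x, y, z). y) (\<lambda>(x, y, z). z))"
  have f3_f2: "?f2 Q" if "?ker Q" "?f3 Q" for Q
    by (rule factorizes2_of_factorizes3[OF K X Y Z that])
  have f3_wci: "?f3 Q \<longleftrightarrow> wci" if "?ker Q" "?f2 Q" for Q
    unfolding wci_def by (rule factorizes3_iff_weak_cond_indep[OF K X Y Z that])
  have c2: "trans_cond_indep \<T> \<X> (\<T> \<Otimes>\<^sub>M \<Y>) \<Z> K X (param_kernel \<T> \<otimes>\<^sub>K Y) Z \<longleftrightarrow>
      trans_cond_indep \<T> \<X> \<Y> \<Z> K X Y Z"
    unfolding trans_cond_indep_def using factorizes3_param_iff[OF K X Y Z] by blast
  have star: "trans_cond_indep \<T> \<X> one_point \<Z> K X star_kernel Z \<longleftrightarrow> star_below \<T> \<X> \<Z> K X Z"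
    unfolding trans_cond_indep_def star_below_def using factorizes3_star_iff[OF K X Z] by blast
  have c4: "trans_cond_indep \<T> \<X> \<Y> \<Z> K X Y Z \<longleftrightarrow> star_below \<T> \<X> \<Z> K X Z \<and> wci"
    unfolding trans_cond_indep_def star_below_def using f3_f2 f3_wci by blast
  have c3: "trans_cond_indep \<T> \<X> \<Y> \<Z> K X Y Z \<longleftrightarrow>
      star_below \<T> \<X> \<Z> K X Z \<and> (\<forall>R. ?ker R \<and> ?f2 R \<longrightarrow> ?f3 R)"
    unfolding c4 star_below_def using f3_wci by blast
  have versions: "\<forall>R R'. ?ker R \<and> ?f2 R \<and> ?ker R' \<and> ?f2 R' \<longrightarrow> (?f3 R \<longleftrightarrow> ?f3 R')"
    using f3_wci by blast
  have c5: "trans_cond_indep one_point \<X> (\<T> \<Otimes>\<^sub>M \<Y>) \<Z> (mixture_kernel \<T> K \<mu>)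
      (lift_rv X) (lift_rv (param_kernel \<T>) \<otimes>\<^sub>K lift_rv Y) (lift_rv Z)"
    if indep: "trans_cond_indep \<T> \<X> \<Y> \<Z> K X Y Z" and \<mu>: "sets \<mu> = sets \<T>" for \<mu>
  proof -
    from indep c2 obtain Q where Q: "?ker Q"
      and fact: "factorizes3 \<T> (\<T> \<Otimes>\<^sub>M \<Y>) \<Z> K X (param_kernel \<T> \<otimes>\<^sub>K Y) Z Q"
      unfolding trans_cond_indep_def by blast
    have TY: "markov_kernel (\<W> \<Otimes>\<^sub>M \<T>) (\<T> \<Otimes>\<^sub>M \<Y>) (param_kernel \<T> \<otimes>\<^sub>K Y)"
      by (rule kernel_tensor_kernel[OF param_kernel_kernel Y])
    show ?thesis
      unfolding trans_cond_indep_def lift_rv_tensor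
      using Q factorizes3_mixture[OF K X TY Z Q \<mu> fact] by blast
  qed
  show ?thesis
    unfolding Let_def c2 star wci_def[symmetric] c3[symmetric] c4[symmetric]
    using versions c5 by blast
qed

end
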